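(* Let $T$ be a finite tree with edge set $E$ (so that $T$ has $|E|+1$ vertices). The tree ideal $I(T)$ is the Stanley--Reisner ideal of the unique (up to isomorphism) stacked simplicial complex of dimension $|E|-1$ which is not a cone and whose associated hypertree is $T$.
   Context: Let $k$ be a field and $T$ a finite tree with vertex set $V$ and edge set $E$ (edges are two-element subsets of $V$). The incidence relation is $C=\{(e,v)\in E\times V \mid v\in e\}$, and $k[x_C]$ is the polynomial ring in the variables $x_{e,v}$, $(e,v)\in C$. The tree ideal $I(T)\subseteq k[x_C]$ is generated by the monomials $x_{e,v}x_{f,w}$, one for each pair of distinct vertices $v,w$ of $T$, where $e$ and $f$ are the edges incident to $v$ and $w$, respectively, on the unique path in $T$ from $v$ to $w$ (possibly $e=f$). A simplicial complex is a cone if some vertex lies in all its facets. A pure simplicial complex $X$ is stacked if its facets can be ordered $F_0,\ldots,F_m$ such that for each $p\ge1$, with $X_{p-1}$ the complex generated by $F_0,\ldots,F_{p-1}$, one has $F_p=G_p\cup\{v_p\}$ where $G_p$ is a face of $X_{p-1}$ and $v_p$ is not a vertex of $X_{p-1}$. If the facets $F_v$ of a stacked complex $X$ are indexed by a set $V$, the associated hypertree has vertex set $V$ and edges the sets $e_G=\{v\in V\mid F_v\supseteq G\}$ with $|e_G|\ge2$, for $G$ a codimension-one face of $X$. An ordinary tree is a hypertree all of whose edges have cardinality $2$. Saying that the associated hypertree is $T$ means that it is $T$ for a suitable indexing of the facets by $V$. *)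

theory Defs
  imports "HOL-Algebra.Ideal" "HOL-Library.Poly_Mapping"
begin

text \<open>A graph is given by its vertex set \<open>V\<close> and its set \<open>E\<close> of two-element edges.
  A path is the list of its vertices, which are pairwise distinct.\<close>

definition path_betw :: "'v set set \<Rightarrow> 'v \<Rightarrow> 'v list \<Rightarrow> 'v \<Rightarrow> bool" where
  "path_betw E v p w \<longleftrightarrow> p \<noteq> [] \<and> hd p = v \<and> last p = w \<and> distinct p \<and>
     (\<forall>i. Suc i < length p \<longrightarrow> {p ! i, p ! Suc i} \<in> E)"

definition graph_cycle :: "'v set set \<Rightarrow> 'v list \<Rightarrow> bool" where
  "graph_cycle E c \<longleftrightarrow> 3 \<le> length c \<and> path_betw E (hd c) c (last c) \<and> {last c, hd c} \<in> E"

definition finite_tree :: "'v set \<Rightarrow> 'v set set \<Rightarrow> bool" where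
  "finite_tree V E \<longleftrightarrow>
     finite V \<and> V \<noteq> {} \<and>
     (\<forall>e\<in>E. e \<subseteq> V \<and> card e = 2) \<and>
     (\<forall>v\<in>V. \<forall>w\<in>V. \<exists>p. path_betw E v p w) \<and>
     (\<nexists>c. graph_cycle E c)"

definition tree_path :: "'v set set \<Rightarrow> 'v \<Rightarrow> 'v \<Rightarrow> 'v list" where
  "tree_path E v w = (THE p. path_betw E v p w)"

text \<open>The first and the last edge of the path from \<open>v\<close> to \<open>w\<close>, meaningful for \<open>v \<noteq> w\<close>.\<close>

definition start_edge :: "'v set set \<Rightarrow> 'v \<Rightarrow> 'v \<Rightarrow> 'v set" where
  "start_edge E v w = (let p = tree_path E v w in {p ! 0, p ! 1})"

definition end_edge :: "'v set set \<Rightarrow> 'v \<Rightarrow> 'v \<Rightarrow> 'v set" where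
  "end_edge E v w = (let p = tree_path E v w in {p ! (length p - 2), p ! (length p - 1)})"

definition incidence :: "'v set \<Rightarrow> 'v set set \<Rightarrow> ('v set \<times> 'v) set" where
  "incidence V E = {(e, v). e \<in> E \<and> v \<in> V \<and> v \<in> e}"

text \<open>The type \<open>('x \<Rightarrow>\<^sub>0 nat) \<Rightarrow>\<^sub>0 'k\<close> consists of all polynomials with variables from the whole
  type \<open>'x\<close>; \<open>poly_ring_on C\<close> is its subring of polynomials in the variables from \<open>C\<close> only.\<close>

definition poly_ring_on :: "'x set \<Rightarrow> (('x \<Rightarrow>\<^sub>0 nat) \<Rightarrow>\<^sub>0 'k::field) ring" where
  "poly_ring_on C =
     \<lparr>carrier = {p. \<forall>m \<in> Poly_Mapping.keys p. Poly_Mapping.keys m \<subseteq> C},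
      monoid.mult = (*), one = 1, zero = 0, add = (+)\<rparr>"

definition poly_var :: "'x \<Rightarrow> ('x \<Rightarrow>\<^sub>0 nat) \<Rightarrow>\<^sub>0 'k::field" where
  "poly_var x = Poly_Mapping.single (Poly_Mapping.single x 1) 1"

definition tree_ideal :: "'v set \<Rightarrow> 'v set set \<Rightarrow> ((('v set \<times> 'v) \<Rightarrow>\<^sub>0 nat) \<Rightarrow>\<^sub>0 'k::field) set" where
  "tree_ideal V E =
     genideal (poly_ring_on (incidence V E))
       {poly_var (start_edge E v w, v) * poly_var (end_edge E v w, w) |v w.
          v \<in> V \<and> w \<in> V \<and> v \<noteq> w}"

definition abstract_complex :: "'a set set \<Rightarrow> bool" where
  "abstract_complex X \<longleftrightarrow> finite X \<and> (\<forall>F\<in>X. finite F) \<and> (\<forall>F\<in>X. \<forall>G. G \<subseteq> F \<longrightarrow> G \<in> X)"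

definition complex_vertices :: "'a set set \<Rightarrow> 'a set" where
  "complex_vertices X = \<Union>X"

definition facets :: "'a set set \<Rightarrow> 'a set set" where
  "facets X = {F \<in> X. \<forall>G\<in>X. F \<subseteq> G \<longrightarrow> F = G}"

text \<open>Dimensions are integers, because the empty face has dimension \<open>-1\<close>.\<close>

definition face_dim :: "'a set \<Rightarrow> int" where
  "face_dim F = int (card F) - 1"

definition complex_dim :: "'a set set \<Rightarrow> int" where
  "complex_dim X = Max (face_dim ` X)"

definition pure_complex :: "'a set set \<Rightarrow> bool" where
  "pure_complex X \<longleftrightarrow> abstract_complex X \<and> (\<forall>F\<in>facets X. face_dim F = complex_dim X)"

definition cone :: "'a set set \<Rightarrow> bool" where
  "cone X \<longleftrightarrow> (\<exists>x\<in>complex_vertices X. \<forall>F\<in>facets X. x \<in> F)"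

definition generated_complex :: "'a set set \<Rightarrow> 'a set set" where
  "generated_complex S = {G. \<exists>F\<in>S. G \<subseteq> F}"

definition stacked :: "'a set set \<Rightarrow> bool" where
  "stacked X \<longleftrightarrow> pure_complex X \<and>
     (\<exists>Fs. Fs \<noteq> [] \<and> distinct Fs \<and> set Fs = facets X \<and>
       (\<forall>p. 1 \<le> p \<and> p < length Fs \<longrightarrow>
         (\<exists>G v. Fs ! p = G \<union> {v} \<and>
                G \<in> generated_complex (set (take p Fs)) \<and>
                v \<notin> complex_vertices (generated_complex (set (take p Fs))))))"

definition hypertree_edges :: "'a set set \<Rightarrow> 'v set \<Rightarrow> ('v \<Rightarrow> 'a set) \<Rightarrow> 'v set set" where
  "hypertree_edges X V F =
     {e. \<exists>G\<in>X. face_dim G = complex_dim X - 1 \<and> e = {v \<in> V. G \<subseteq> F v} \<and> 2 \<le> card e}"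

definition associated_hypertree :: "'a set set \<Rightarrow> 'v set \<Rightarrow> 'v set set \<Rightarrow> bool" where
  "associated_hypertree X V E \<longleftrightarrow>
     (\<exists>F. bij_betw F V (facets X) \<and> hypertree_edges X V F = E)"

definition complex_iso :: "'a set set \<Rightarrow> 'b set set \<Rightarrow> bool" where
  "complex_iso X Y \<longleftrightarrow>
     (\<exists>f. bij_betw f (complex_vertices X) (complex_vertices Y) \<and> (\<lambda>F. f ` F) ` X = Y)"

definition stanley_reisner_ideal :: "'a set set \<Rightarrow> (('a \<Rightarrow>\<^sub>0 nat) \<Rightarrow>\<^sub>0 'k::field) set" where
  "stanley_reisner_ideal X =
     genideal (poly_ring_on (complex_vertices X))
       {\<Prod>x\<in>F. poly_var x |F. F \<subseteq> complex_vertices X \<and> F \<notin> X}"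

lemma cring_poly_ring_on: "cring (poly_ring_on C :: (('x \<Rightarrow>\<^sub>0 nat) \<Rightarrow>\<^sub>0 'k::field) ring)"
proof -
  let ?K = "{p :: ('x \<Rightarrow>\<^sub>0 nat) \<Rightarrow>\<^sub>0 'k.
               \<forall>m \<in> Poly_Mapping.keys p. Poly_Mapping.keys m \<subseteq> C}"
  let ?R = "poly_ring_on C :: (('x \<Rightarrow>\<^sub>0 nat) \<Rightarrow>\<^sub>0 'k) ring"
  have sel: "carrier ?R = ?K" "\<And>p q. p \<otimes>\<^bsub>?R\<^esub> q = p * q" "\<And>p q. p \<oplus>\<^bsub>?R\<^esub> q = p + q"
    "\<one>\<^bsub>?R\<^esub> = 1" "\<zero>\<^bsub>?R\<^esub> = 0"
    by (simp_all add: poly_ring_on_def)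
  have plus: "p + q \<in> ?K" if "p \<in> ?K" "q \<in> ?K" for p q
    using that Poly_Mapping.keys_add[of p q] by blast
  have neg: "- p \<in> ?K" if "p \<in> ?K" for p
    using that by simp
  have zero: "0 \<in> ?K" and one: "1 \<in> ?K"
    by simp_all
  have times: "p * q \<in> ?K" if p: "p \<in> ?K" and q: "q \<in> ?K" for p q
  proof (rule CollectI, rule ballI)
    fix m assume "m \<in> Poly_Mapping.keys (p * q)"
    then obtain a b where ab: "m = a + b" "a \<in> Poly_Mapping.keys p" "b \<in> Poly_Mapping.keys q"
      using Poly_Mapping.keys_mult[of p q] by blast
    then have "Poly_Mapping.keys a \<subseteq> C" "Poly_Mapping.keys b \<subseteq> C"
      using p q by blast+
    then show "Poly_Mapping.keys m \<subseteq> C"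
      using Poly_Mapping.keys_add[of a b] ab(1) by blast
  qed
  have "abelian_group ?R"
  proof (rule abelian_groupI, unfold sel)
    show "\<exists>y\<in>?K. y + x = 0" if "x \<in> ?K" for x
      by (rule bexI[OF _ neg[OF that]]) (rule left_minus)
  qed (rule plus zero add.assoc add.commute add_0 | assumption)+
  moreover have "comm_monoid ?R"
    by (rule comm_monoidI, unfold sel)
      (rule times one mult.assoc mult.commute mult_1 | assumption)+
  ultimately show ?thesis
    by (rule cringI) (unfold sel, rule distrib_right)
qed

end

theory Submission
  imports Defs
begin

text \<open>
  For an edge \<open>e\<close> of the tree and an endpoint \<open>v\<close> of \<open>e\<close>, let the half-tree \<open>H(e, v)\<close> be the component
  of \<open>v\<close> in \<open>T - e\<close>. If \<open>v \<noteq> w\<close>, then the path from \<open>v\<close> to \<open>w\<close> starts with the only edge \<open>e\<close> at \<open>v\<close>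
  such that \<open>w\<close> lies outside \<open>H(e, v)\<close>. Hence \<open>x\<^bsub>e,v\<^esub> x\<^bsub>f,w\<^esub>\<close> is a generator of the tree ideal
  exactly when \<open>H(e, v)\<close> and \<open>H(f, w)\<close> are disjoint (\<open>opposed_iff_disjoint\<close>).

  The complex is generated by the faces \<open>F\<^sub>u = {(e, v). u \<in> H(e, v)}\<close>, one for each vertex \<open>u\<close>, which
  select from every edge its endpoint nearer to \<open>u\<close>. A set of incidences without a generator pair is
  a family of pairwise intersecting half-trees, and so by the Helly property of subtrees
  (\<open>near_face_Helly\<close>) it is contained in some \<open>F\<^sub>u\<close>. This makes the tree ideal the Stanley--Reisner
  ideal of the complex. The facets of adjacent vertices differ in one element only, so any ordering
  of \<open>V\<close> that starts at a root and keeps attaching neighbours stacks the complex; and a ridge lies in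
  two facets only if these belong to adjacent vertices, so the hypertree is \<open>T\<close>.

  For uniqueness, let \<open>Y\<close> be stacked with facets \<open>K\<^sub>v\<close> and hypertree \<open>T\<close>, and not a cone. For an edge
  \<open>e = {v, w}\<close> the set \<open>K\<^sub>v - K\<^sub>w\<close> has one element \<open>y(e, v)\<close>. Since no vertex of \<open>Y\<close> lies in all facets,
  each is lost at some edge of a path, so \<open>y\<close> maps the incidences onto the vertices of \<open>Y\<close>. Stacking
  adds one vertex per facet, so both complexes have \<open>2|E|\<close> vertices and \<open>y\<close> is a bijection. Then
  \<open>y(e, v)\<close> is lost at \<open>e\<close> only and therefore belongs to \<open>K\<^sub>u\<close> for all \<open>u\<close> in \<open>H(e, v)\<close>, which gives
  \<open>y(F\<^sub>u) = K\<^sub>u\<close>.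
\<close>

section \<open>Connectedness and paths\<close>

text \<open>\<open>linked D x y\<close>: the vertices \<open>x\<close> and \<open>y\<close> are connected by edges from \<open>D\<close>. Every vertex is linked
  to itself, whether or not it lies on an edge of \<open>D\<close>.\<close>

definition linked :: "'v set set \<Rightarrow> 'v \<Rightarrow> 'v \<Rightarrow> bool" where
  "linked D = (\<lambda>x y. {x, y} \<in> D)\<^sup>*\<^sup>*"

lemma linked_refl [simp]: "linked D x x"
  by (simp add: linked_def)

lemma linked_trans: "linked D x y \<Longrightarrow> linked D y z \<Longrightarrow> linked D x z"
  unfolding linked_def by (rule rtranclp_trans)

lemma linked_edge: "{x, y} \<in> D \<Longrightarrow> linked D x y"
  by (simp add: linked_def r_into_rtranclp)

lemma linked_commute: "linked D x y \<longleftrightarrow> linked D y x"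
proof -
  have "symp (\<lambda>x y. {x, y} \<in> D)"
    by (auto intro!: sympI simp: insert_commute)
  then have "symp (linked D)"
    unfolding linked_def by (rule symp_rtranclp)
  then show ?thesis
    by (auto dest: sympD)
qed

lemma linked_mono: "linked D x y \<Longrightarrow> D \<subseteq> D' \<Longrightarrow> linked D' x y"
  unfolding linked_def by (rule rtranclp_mono[THEN predicate2D]) auto

lemma linked_induct [consumes 1, case_names base step]:
  assumes "linked D x y" "P x"
    and "\<And>y z. linked D x y \<Longrightarrow> {y, z} \<in> D \<Longrightarrow> P y \<Longrightarrow> P z"
  shows "P y"
  using assms unfolding linked_def by (rule rtranclp_induct)

lemma linked_converse_induct [consumes 1, case_names base step]:
  assumes "linked D x y" "P y"
    and "\<And>x z. {x, z} \<in> D \<Longrightarrow> linked D z y \<Longrightarrow> P z \<Longrightarrow> P x"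
  shows "P x"
  using assms unfolding linked_def by (rule converse_rtranclp_induct)

lemma linked_crossing:
  assumes "linked D x y" "P x" "\<not> P y"
  obtains a b where "{a, b} \<in> D" "linked D x a" "P a" "\<not> P b"
  using assms(1,3,2) by (induction rule: linked_induct) auto

lemma path_betw_successively:
  "path_betw D v p w \<longleftrightarrow>
     p \<noteq> [] \<and> hd p = v \<and> last p = w \<and> distinct p \<and> successively (\<lambda>x y. {x, y} \<in> D) p"
  unfolding path_betw_def successively_conv_nth by auto

lemma path_betw_Cons:
  "path_betw D v (v # x # xs) w \<longleftrightarrow> {v, x} \<in> D \<and> v \<notin> set (x # xs) \<and> path_betw D x (x # xs) w"
  by (auto simp: path_betw_successively)

lemma path_betw_cases:
  assumes "path_betw D v p w" "v \<noteq> w"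
  obtains x xs where "p = v # x # xs" "{v, x} \<in> D" "v \<notin> set (x # xs)" "path_betw D x (x # xs) w"
proof -
  obtain q where q: "p = v # q" "q \<noteq> []"
    using assms by (cases p) (auto simp: path_betw_successively split: if_splits)
  then obtain x xs where "q = x # xs" by (cases q) auto
  then show thesis using that assms q path_betw_Cons by metis
qed

lemma path_betw_self: "path_betw D v p v \<Longrightarrow> p = [v]"
  by (cases p) (auto simp: path_betw_def split: if_splits)

lemma path_betw_linked:
  assumes "path_betw D v p w"
  shows "linked {e \<in> D. e \<subseteq> set p} v w"
  using assms
proof (induction p arbitrary: v)
  case Nil
  then show ?case by (simp add: path_betw_successively)
next
  case (Cons u p)
  show ?case
  proof (cases "v = w")
    case False
    then obtain x xs where x: "u # p = v # x # xs" "{v, x} \<in> D" "path_betw D x (x # xs) w"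
      using path_betw_cases Cons.prems(1) by metis
    have "linked {e \<in> D. e \<subseteq> set p} x w"
      using Cons.IH[of x] x by auto
    then have "linked {e \<in> D. e \<subseteq> set (u # p)} x w"
      by (rule linked_mono) auto
    moreover have "{v, x} \<in> {e \<in> D. e \<subseteq> set (u # p)}"
      using x by auto
    ultimately show ?thesis
      by (blast intro: linked_edge linked_trans)
  qed simp
qed

lemma path_betw_rev: "path_betw D v p w \<Longrightarrow> path_betw D w (rev p) v"
  by (auto simp: path_betw_successively successively_rev hd_rev last_rev insert_commute)

lemma linked_imp_path:
  assumes "linked D v w"
  shows "\<exists>p. path_betw D v p w"
  using assms
proof (induction rule: linked_converse_induct)
  case base
  have "path_betw D w [w] w" by (simp add: path_betw_successively)
  then show ?case ..
next
  case (step v x)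
  then obtain p where p: "path_betw D x p w" by blast
  show ?case
  proof (cases "v \<in> set p")
    case True
    then obtain xs ys where "p = xs @ v # ys" by (meson split_list)
    then have "path_betw D v (v # ys) w"
      using p by (auto simp: path_betw_successively successively_append_iff)
    then show ?thesis ..
  next
    case False
    then have "path_betw D v (v # p) w"
      using p step(1) by (auto simp: path_betw_successively successively_Cons)
    then show ?thesis ..
  qed
qed

text \<open>If \<open>w\<close> is outside the component of \<open>v\<close> in \<open>D - {e}\<close>, then an edge \<open>f\<close> at \<open>w\<close> is not used
  inside that component, which therefore survives the removal of \<open>f\<close>.\<close>

lemma linked_side_avoiding:
  assumes "linked (D - {e}) v u" "\<not> linked (D - {e}) v w" "w \<in> f"
  shows "linked (D - {f}) v u"
  using assms(1)
proof (induction rule: linked_induct)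
  case (step y z)
  have "linked (D - {e}) v z" using step.hyps linked_edge linked_trans by metis
  then have "f \<noteq> {y, z}" using step.hyps(1) assms(2,3) by auto
  then have "{y, z} \<in> D - {f}" using step.hyps(2) by auto
  then show ?case using step.IH linked_edge linked_trans by metis
qed simp

text \<open>An enumeration of vertices that starts with an arbitrary root and in which every later vertex
  is new and adjacent to an earlier one.\<close>

inductive search_order :: "'v set set \<Rightarrow> 'v list \<Rightarrow> bool" for D where
  root: "search_order D [r]"
| attach: "search_order D us \<Longrightarrow> y \<in> set us \<Longrightarrow> x \<notin> set us \<Longrightarrow> {y, x} \<in> D
    \<Longrightarrow> search_order D (us @ [x])"

lemma search_order_distinct: "search_order D us \<Longrightarrow> distinct us \<and> us \<noteq> []"
  by (induction rule: search_order.induct) auto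

text \<open>Consecutive attachments only use edges between enumerated vertices.\<close>

lemma search_order_linked:
  assumes "search_order D us" "x \<in> set us" "y \<in> set us" "\<not> e \<subseteq> set us"
  shows "linked (D - {e}) x y"
  using assms
proof (induction arbitrary: x y rule: search_order.induct)
  case (attach us b a)
  have IH: "linked (D - {e}) x y" if "x \<in> set us" "y \<in> set us" for x y
    using attach.IH that attach.prems by auto
  have "{b, a} \<noteq> e" using attach.prems attach.hyps by auto
  then have "linked (D - {e}) b a" using attach.hyps by (intro linked_edge) auto
  then have "linked (D - {e}) x b" if "x \<in> set (us @ [a])" for x
    using that IH attach.hyps by (auto simp: linked_commute)
  then show ?case using attach.prems linked_commute linked_trans by metis
qed simp

lemma search_order_exists:
  assumes fin: "finite U" and ne: "U \<noteq> {}"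
    and conn: "\<And>v w. v \<in> U \<Longrightarrow> w \<in> U \<Longrightarrow> linked D v w"
    and sub: "\<And>e. e \<in> D \<Longrightarrow> e \<subseteq> U"
  shows "\<exists>us. search_order D us \<and> set us = U"
proof -
  let ?P = "\<lambda>us. search_order D us \<and> set us \<subseteq> U"
  obtain r where "r \<in> U" using ne by blast
  then have "?P [r]" by (simp add: search_order.root)
  moreover have "\<forall>us. ?P us \<longrightarrow> length us < Suc (card U)"
    using search_order_distinct distinct_card fin card_mono by (metis less_Suc_eq_le)
  ultimately obtain us where us: "?P us" and max: "\<And>us'. ?P us' \<Longrightarrow> length us' \<le> length us"
    using ex_has_greatest_nat[of ?P "[r]" length] by blast
  \<comment> \<open>A longest such enumeration is complete, as otherwise an edge leaves it.\<close>
  have "set us = U"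
  proof (rule ccontr)
    assume "set us \<noteq> U"
    then obtain w where w: "w \<in> U" "w \<notin> set us" using us by blast
    obtain v where v: "v \<in> set us" using us search_order_distinct by (metis list.set_intros(1) neq_Nil_conv)
    then have "linked D v w" using conn us w by blast
    then obtain a b where ab: "{a, b} \<in> D" "a \<in> set us" "b \<notin> set us"
      using linked_crossing[of D v w "\<lambda>x. x \<in> set us"] v w by metis
    then have "?P (us @ [b])" using us sub[OF ab(1)] search_order.attach by auto
    then show False using max by fastforce
  qed
  then show ?thesis using us by blast
qed

section \<open>Facets and vertices of complexes\<close>

lemma face_in_facet:
  assumes "abstract_complex X" "S \<in> X"
  obtains F where "F \<in> facets X" "S \<subseteq> F"
proof -
  obtain F where "F \<in> X" "S \<subseteq> F" "\<forall>G\<in>X. F \<subseteq> G \<longrightarrow> F = G"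
    using finite_has_maximal2[of X S] assms unfolding abstract_complex_def by metis
  then show thesis using that by (auto simp: facets_def)
qed

lemma generated_complex_facets:
  assumes "abstract_complex X"
  shows "generated_complex (facets X) = X"
proof
  show "generated_complex (facets X) \<subseteq> X"
    using assms by (auto simp: generated_complex_def facets_def abstract_complex_def)
  show "X \<subseteq> generated_complex (facets X)"
    using face_in_facet[OF assms] by (auto simp: generated_complex_def) metis
qed

lemma complex_vertices_generated: "complex_vertices (generated_complex S) = \<Union>S"
  by (auto simp: complex_vertices_def generated_complex_def)

lemma image_generated_complex:
  "(\<lambda>G. f ` G) ` generated_complex S = generated_complex ((\<lambda>F. f ` F) ` S)"
  by (auto simp: generated_complex_def subset_image_iff image_iff)

text \<open>The first facet has \<open>n\<close> vertices, and every later one contributes exactly one new vertex.\<close>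

lemma stacked_card_vertices:
  assumes X: "stacked X" and card: "\<And>F. F \<in> facets X \<Longrightarrow> card F = n"
  shows "card (complex_vertices X) + 1 = n + card (facets X)"
proof -
  have ac: "abstract_complex X"
    using X by (simp add: stacked_def pure_complex_def)
  then have fin: "finite F" if "F \<in> facets X" for F
    using that by (auto simp: abstract_complex_def facets_def)
  obtain Fs where Fs: "Fs \<noteq> []" "distinct Fs" "set Fs = facets X"
    and step: "\<And>p. 1 \<le> p \<Longrightarrow> p < length Fs \<Longrightarrow> \<exists>G v. Fs ! p = G \<union> {v} \<and>
      G \<in> generated_complex (set (take p Fs)) \<and>
      v \<notin> complex_vertices (generated_complex (set (take p Fs)))"
    using X unfolding stacked_def by metis
  have "k \<le> length Fs \<Longrightarrow> card (\<Union>(set (take k Fs))) + 1 = n + k" if "1 \<le> k" for k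
    using that
  proof (induction rule: nat_induct_at_least)
    case base
    then show ?case using Fs card[of "hd Fs"] by (cases Fs) auto
  next
    case (Suc k)
    let ?U = "\<Union>(set (take k Fs))"
    obtain G v where G: "Fs ! k = G \<union> {v}" "G \<in> generated_complex (set (take k Fs))"
        "v \<notin> complex_vertices (generated_complex (set (take k Fs)))"
      using step[of k] Suc by auto
    then have v: "v \<notin> ?U" and "G \<subseteq> ?U"
      unfolding complex_vertices_generated by (auto simp: generated_complex_def)
    then have "\<Union>(set (take (Suc k) Fs)) = insert v ?U"
      using Suc.prems G(1) by (auto simp: take_Suc_conv_app_nth)
    moreover have "finite ?U"
      using fin Fs(3) set_take_subset[of k Fs] by (intro finite_Union) auto
    ultimately show ?case using Suc v by simp
  qed
  from this[of "length Fs"] have "card (\<Union>(facets X)) + 1 = n + length Fs"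
    using Fs by (simp add: Suc_le_eq)
  moreover have "length Fs = card (facets X)"
    using Fs distinct_card by metis
  moreover have "complex_vertices X = \<Union>(facets X)"
    using generated_complex_facets[OF ac] complex_vertices_generated by metis
  ultimately show ?thesis by simp
qed

section \<open>Stanley--Reisner ideals generated by quadratic monomials\<close>

lemma poly_ring_on_simps:
  "p \<otimes>\<^bsub>poly_ring_on C\<^esub> q = p * q" "\<one>\<^bsub>poly_ring_on C\<^esub> = 1"
  by (simp_all add: poly_ring_on_def)

lemma poly_var_carrier: "x \<in> C \<Longrightarrow> poly_var x \<in> carrier (poly_ring_on C)"
  by (simp add: poly_ring_on_def poly_var_def)

lemma prod_poly_var_carrier:
  fixes C :: "'x set"
  assumes "F \<subseteq> C"
  shows "(\<Prod>x\<in>F. poly_var x :: ('x \<Rightarrow>\<^sub>0 nat) \<Rightarrow>\<^sub>0 'k::field) \<in> carrier (poly_ring_on C)"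
proof -
  interpret cring "poly_ring_on C :: (('x \<Rightarrow>\<^sub>0 nat) \<Rightarrow>\<^sub>0 'k) ring"
    by (rule cring_poly_ring_on)
  show ?thesis
    using assms
  proof (induction F rule: infinite_finite_induct)
    case (insert x F)
    then have "poly_var x \<otimes>\<^bsub>poly_ring_on C\<^esub> (\<Prod>x\<in>F. poly_var x :: ('x \<Rightarrow>\<^sub>0 nat) \<Rightarrow>\<^sub>0 'k)
        \<in> carrier (poly_ring_on C)"
      by (intro m_closed poly_var_carrier) auto
    then show ?case using insert.hyps by (simp add: poly_ring_on_simps)
  qed (use one_closed in \<open>simp_all add: poly_ring_on_simps\<close>)
qed

text \<open>If the nonfaces are the vertex sets that contain a pair from \<open>N\<close>, then the monomials of the pairs
  generate the Stanley--Reisner ideal.\<close>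

lemma stanley_reisner_ideal_eq_quadratic:
  fixes X :: "'x set set" and C :: "'x set"
    and N :: "('x \<times> 'x) set"
  defines "C \<equiv> complex_vertices X"
  defines "J \<equiv> {poly_var c * poly_var d |c d. (c, d) \<in> N} :: (('x \<Rightarrow>\<^sub>0 nat) \<Rightarrow>\<^sub>0 'k::field) set"
  assumes fin: "finite C"
    and N: "\<And>c d. (c, d) \<in> N \<Longrightarrow> c \<in> C \<and> d \<in> C \<and> c \<noteq> d"
    and nonface: "\<And>S. S \<subseteq> C \<Longrightarrow> S \<notin> X \<longleftrightarrow> (\<exists>c\<in>S. \<exists>d\<in>S. (c, d) \<in> N)"
  shows "stanley_reisner_ideal X = genideal (poly_ring_on C) J"
proof -
  let ?R = "poly_ring_on C :: (('x \<Rightarrow>\<^sub>0 nat) \<Rightarrow>\<^sub>0 'k::field) ring"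
  let ?M = "{\<Prod>x\<in>F. poly_var x |F. F \<subseteq> C \<and> F \<notin> X} :: (('x \<Rightarrow>\<^sub>0 nat) \<Rightarrow>\<^sub>0 'k) set"
  interpret cring ?R by (rule cring_poly_ring_on)
  have M: "?M \<subseteq> carrier ?R" using prod_poly_var_carrier by blast
  have pair: "(\<Prod>x\<in>{c, d}. poly_var x) = (poly_var c * poly_var d :: ('x \<Rightarrow>\<^sub>0 nat) \<Rightarrow>\<^sub>0 'k)"
    if "(c, d) \<in> N" for c d
    using N[OF that] by simp
  have JM: "J \<subseteq> ?M"
  proof
    fix p assume "p \<in> J"
    then obtain c d where cd: "p = poly_var c * poly_var d" "(c, d) \<in> N"
      by (auto simp: J_def)
    have "{c, d} \<subseteq> C" using N[OF cd(2)] by simp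
    moreover from this have "{c, d} \<notin> X" using nonface cd(2) by blast
    moreover have "p = (\<Prod>x\<in>{c, d}. poly_var x)" using pair[OF cd(2)] cd(1) by simp
    ultimately show "p \<in> ?M" by blast
  qed
  have J: "J \<subseteq> carrier ?R" using JM M by blast
  interpret J: ideal "Idl\<^bsub>?R\<^esub> J" ?R by (rule genideal_ideal[OF J])
  have "?M \<subseteq> Idl\<^bsub>?R\<^esub> J"
  proof
    fix p assume "p \<in> ?M"
    then obtain S where S: "p = (\<Prod>x\<in>S. poly_var x)" "S \<subseteq> C" "S \<notin> X" by blast
    then obtain c d where cd: "c \<in> S" "d \<in> S" "(c, d) \<in> N" using nonface by blast
    have "S = {c, d} \<union> (S - {c, d})" using cd by blast
    then have "p = (\<Prod>x\<in>{c, d} \<union> (S - {c, d}). poly_var x)" using S by simp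
    also have "\<dots> = (\<Prod>x\<in>{c, d}. poly_var x) * (\<Prod>x\<in>S - {c, d}. poly_var x)"
      using finite_subset[OF S(2) fin] by (intro prod.union_disjoint) auto
    finally have "p = (poly_var c * poly_var d) \<otimes>\<^bsub>?R\<^esub> (\<Prod>x\<in>S - {c, d}. poly_var x)"
      using pair cd by (simp add: poly_ring_on_simps)
    moreover have "poly_var c * poly_var d \<in> Idl\<^bsub>?R\<^esub> J"
      using genideal_self[OF J] cd(3) by (auto simp: J_def)
    moreover have "(\<Prod>x\<in>S - {c, d}. poly_var x) \<in> carrier ?R"
      using S(2) by (intro prod_poly_var_carrier) auto
    ultimately show "p \<in> Idl\<^bsub>?R\<^esub> J" using J.I_r_closed by metis
  qed
  then have "Idl\<^bsub>?R\<^esub> ?M \<subseteq> Idl\<^bsub>?R\<^esub> J"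
    by (rule genideal_minimal[OF J.is_ideal])
  moreover have "Idl\<^bsub>?R\<^esub> J \<subseteq> Idl\<^bsub>?R\<^esub> ?M"
    using JM genideal_self[OF M] by (intro genideal_minimal genideal_ideal[OF M]) blast
  ultimately show ?thesis by (simp add: stanley_reisner_ideal_def C_def)
qed

section \<open>Paths and half-trees in a tree\<close>

text \<open>The set of the incidences \<open>(e, v)\<close> such that, after removal of \<open>e\<close>, the vertex \<open>u\<close> is still
  connected to \<open>v\<close>. In a tree, \<open>v\<close> is then the endpoint of \<open>e\<close> nearer to \<open>u\<close>.\<close>

definition near_face :: "'v set set \<Rightarrow> 'v \<Rightarrow> ('v set \<times> 'v) set" where
  "near_face E u = {(e, v). e \<in> E \<and> v \<in> e \<and> linked (E - {e}) u v}"

locale tree =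
  fixes V :: "'v set" and E :: "'v set set"
  assumes tree: "finite_tree V E"
begin

lemma finite_V: "finite V" and V_nonempty: "V \<noteq> {}"
  and edge_subset: "e \<in> E \<Longrightarrow> e \<subseteq> V" and edge_card: "e \<in> E \<Longrightarrow> card e = 2"
  and path_exists: "v \<in> V \<Longrightarrow> w \<in> V \<Longrightarrow> \<exists>p. path_betw E v p w"
  and acyclic: "\<not> graph_cycle E c"
  using tree unfolding finite_tree_def by blast+

lemma finite_E: "finite E"
  using edge_subset finite_V by (meson Pow_iff finite_Pow_iff finite_subset subsetI)

lemma edgeE:
  assumes "e \<in> E" "v \<in> e"
  obtains w where "e = {v, w}" "v \<noteq> w" "v \<in> V" "w \<in> V"
proof -
  obtain x y where "e = {x, y}" "x \<noteq> y"
    using edge_card[OF assms(1)] by (meson card_2_iff)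
  with assms edge_subset[OF assms(1)] that show thesis
    by (metis insert_commute insert_iff insert_subset singletonD)
qed

lemma linked_all:
  assumes "v \<in> V" "w \<in> V"
  shows "linked E v w"
proof -
  obtain p where "path_betw E v p w" using path_exists assms by blast
  then show ?thesis by (rule linked_mono[OF path_betw_linked]) blast
qed

lemma edge_ends_distinct: "{a, b} \<in> E \<Longrightarrow> a \<noteq> b"
  using edge_card by fastforce

text \<open>A path between the endpoints that avoids the edge would close up to a cycle.\<close>

lemma edge_ends_separated:
  assumes "{a, b} \<in> E"
  shows "\<not> linked (E - {{a, b}}) a b"
proof
  assume "linked (E - {{a, b}}) a b"
  then obtain p where p: "path_betw (E - {{a, b}}) a p b"
    using linked_imp_path by metis
  then obtain x xs where x: "p = a # x # xs" "{a, x} \<in> E - {{a, b}}"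
    using path_betw_cases edge_ends_distinct[OF assms] by metis
  have "xs \<noteq> []"
    using p x by (auto simp: path_betw_def)
  then have "3 \<le> length p"
    using x(1) by (cases xs) auto
  then have "graph_cycle E p"
    using p assms by (auto simp: graph_cycle_def path_betw_def insert_commute)
  then show False using acyclic by blast
qed

text \<open>Removing an edge leaves two half-trees, which partition the vertices.\<close>

lemma edge_sides:
  assumes e: "{a, b} \<in> E" and u: "u \<in> V"
  shows "linked (E - {{a, b}}) u b \<longleftrightarrow> \<not> linked (E - {{a, b}}) u a"
proof -
  let ?L = "linked (E - {{a, b}})"
  have "a \<in> V" using edge_subset[OF e] by simp
  then have "linked E u a" using linked_all u by simp
  then have "?L u a \<or> ?L u b"
  proof (induction rule: linked_converse_induct)
    case (step u x)
    show ?case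
    proof (cases "{u, x} = {a, b}")
      case True
      then have "u = a \<or> u = b" by (auto simp: doubleton_eq_iff)
      then show ?thesis by auto
    next
      case False
      then have "{u, x} \<in> E - {{a, b}}" using step by simp
      then show ?thesis using step.IH
        by (meson linked_edge linked_trans)
    qed
  qed simp
  moreover have "\<not> (?L u a \<and> ?L u b)"
    using edge_ends_separated[OF e] linked_commute linked_trans by metis
  ultimately show ?thesis by blast
qed

lemma path_unique: "path_betw E v p w \<Longrightarrow> path_betw E v q w \<Longrightarrow> p = q"
proof (induction p arbitrary: v q)
  case Nil
  then show ?case by (simp add: path_betw_def)
next
  case (Cons u p)
  show ?case
  proof (cases "v = w")
    case True
    then have "u # p = [v]" "q = [v]"
      using Cons.prems path_betw_self by metis+
    then show ?thesis by simp
  next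
    case False
    obtain x xs where x: "u # p = v # x # xs" "{v, x} \<in> E" "v \<notin> set (x # xs)"
        "path_betw E x (x # xs) w"
      using path_betw_cases[OF Cons.prems(1) False] by metis
    obtain y ys where y: "q = v # y # ys" "{v, y} \<in> E" "v \<notin> set (y # ys)"
        "path_betw E y (y # ys) w"
      using path_betw_cases[OF Cons.prems(2) False] by metis
    have "x = y"
    proof (rule ccontr)
      assume "x \<noteq> y"
      let ?L = "linked (E - {{v, x}})"
      have "?L x w"
        by (rule linked_mono[OF path_betw_linked[OF x(4)]]) (use x(3) in auto)
      moreover have "?L y w"
        by (rule linked_mono[OF path_betw_linked[OF y(4)]]) (use y(3) in auto)
      moreover have "{v, y} \<in> E - {{v, x}}"
        using y(2) \<open>x \<noteq> y\<close> by (auto simp: doubleton_eq_iff)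
      ultimately have "?L v x"
        by (meson linked_edge linked_commute linked_trans)
      then show False using edge_ends_separated x(2) by blast
    qed
    then show ?thesis using Cons.IH x y by auto
  qed
qed

lemma tree_path_eq: "path_betw E v p w \<Longrightarrow> tree_path E v w = p"
  unfolding tree_path_def by (rule the_equality) (simp_all add: path_unique)

text \<open>The first edge of the path from \<open>v\<close> to \<open>w\<close> is the only edge at \<open>v\<close> whose half-tree on the side
  of \<open>v\<close> misses \<open>w\<close>.\<close>

lemma start_edge_iff:
  assumes "v \<in> V" "w \<in> V" "v \<noteq> w"
  shows "start_edge E v w = e \<longleftrightarrow> e \<in> E \<and> v \<in> e \<and> \<not> linked (E - {e}) v w"
proof -
  obtain p where p: "path_betw E v p w" using path_exists assms by blast
  then obtain x xs where x: "p = v # x # xs" "{v, x} \<in> E" "v \<notin> set (x # xs)"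
      "path_betw E x (x # xs) w"
    using path_betw_cases assms(3) by metis
  have start: "start_edge E v w = {v, x}"
    using tree_path_eq[OF p] x(1) by (simp add: start_edge_def)
  have L: "linked (E - {f}) x w" if "v \<in> f" for f
    by (rule linked_mono[OF path_betw_linked[OF x(4)]]) (use x(3) that in auto)
  have "\<not> linked (E - {{v, x}}) v w"
    using L[of "{v, x}"] edge_ends_separated[OF x(2)]
    by (metis insertI1 linked_commute linked_trans)
  moreover have "e = {v, x}" if "e \<in> E" "v \<in> e" "\<not> linked (E - {e}) v w"
  proof (rule ccontr)
    assume "e \<noteq> {v, x}"
    then have "{v, x} \<in> E - {e}" using x(2) by simp
    then show False using L[OF that(2)] that(3)
      by (meson linked_edge linked_trans)
  qed
  ultimately show ?thesis using start x(2) by auto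
qed

lemma end_edge_eq:
  assumes "v \<in> V" "w \<in> V" "v \<noteq> w"
  shows "end_edge E v w = start_edge E w v"
proof -
  obtain p where p: "path_betw E v p w" using path_exists assms by blast
  then have "2 \<le> length p" using path_betw_cases assms(3) by (metis length_Cons One_nat_def Suc_1 Suc_le_mono le0)
  then have "p \<noteq> []" by auto
  then show ?thesis
    using \<open>2 \<le> length p\<close> tree_path_eq[OF p] tree_path_eq[OF path_betw_rev[OF p]] rev_nth[of 0 p] rev_nth[of 1 p]
      \<open>p \<noteq> []\<close>
    by (simp add: start_edge_def end_edge_def Let_def insert_commute numeral_2_eq_2)
qed

lemma start_edge_in: "v \<in> V \<Longrightarrow> w \<in> V \<Longrightarrow> v \<noteq> w \<Longrightarrow>
    start_edge E v w \<in> E \<and> v \<in> start_edge E v w \<and> \<not> linked (E - {start_edge E v w}) v w"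
  using start_edge_iff by blast

text \<open>For a fixed root, every other vertex corresponds to the edge that leads from it to the root.\<close>

lemma card_vertices: "card V = card E + 1"
proof -
  obtain r where r: "r \<in> V" using V_nonempty by blast
  let ?f = "\<lambda>v. start_edge E v r"
  have "bij_betw ?f (V - {r}) E"
  proof (rule bij_betw_imageI)
    show "inj_on ?f (V - {r})"
    proof (rule inj_onI, rule ccontr)
      fix v w assume vw: "v \<in> V - {r}" "w \<in> V - {r}" "?f v = ?f w" "v \<noteq> w"
      let ?e = "?f v"
      have v: "?e \<in> E" "v \<in> ?e" "\<not> linked (E - {?e}) v r"
        using start_edge_in[of v r] vw r by auto
      have w: "w \<in> ?e" "\<not> linked (E - {?e}) w r"
        using start_edge_in[of w r] vw r by auto
      have "?e = {v, w}" using v w vw edgeE by (metis insertE singletonD)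
      then show False using edge_sides[of v w r] v w r linked_commute by metis
    qed
    show "?f ` (V - {r}) = E"
    proof
      show "?f ` (V - {r}) \<subseteq> E" using start_edge_in r by auto
      show "E \<subseteq> ?f ` (V - {r})"
      proof
        fix e assume e: "e \<in> E"
        then obtain a b where ab: "e = {a, b}" "a \<in> V" "b \<in> V"
          by (metis edgeE edge_card card_2_iff insertI1)
        obtain c where c: "c \<in> e" "c \<in> V" "\<not> linked (E - {e}) c r"
          using edge_sides[of a b r] ab e r linked_commute
          by (metis insertI1 insertI2)
        then have "c \<noteq> r" by auto
        then have "?f c = e" using start_edge_iff c e r by blast
        then show "e \<in> ?f ` (V - {r})" using c \<open>c \<noteq> r\<close> by blast
      qed
    qed
  qed
  then have "card (V - {r}) = card E" by (rule bij_betw_same_card)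
  moreover have "card V > 0" using r finite_V card_gt_0_iff by blast
  ultimately show ?thesis using r by simp
qed

section \<open>The facets of the tree complex\<close>

lemma mem_near_face: "(e, v) \<in> near_face E u \<longleftrightarrow> e \<in> E \<and> v \<in> e \<and> linked (E - {e}) u v"
  by (simp add: near_face_def)

lemma near_face_self: "e \<in> E \<Longrightarrow> v \<in> e \<Longrightarrow> (e, v) \<in> near_face E v"
  by (simp add: mem_near_face)

lemma incidence_iff: "(e, v) \<in> incidence V E \<longleftrightarrow> e \<in> E \<and> v \<in> e"
  using edge_subset by (auto simp: incidence_def)

lemma finite_incidence: "finite (incidence V E)"
  by (rule finite_subset[of _ "E \<times> V"]) (auto simp: incidence_def finite_E finite_V)

lemma near_face_subset: "near_face E u \<subseteq> incidence V E"
  using incidence_iff by (auto simp: mem_near_face)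

lemma finite_near_face: "finite (near_face E u)"
  using near_face_subset finite_incidence by (rule finite_subset)

lemma bij_betw_near_face:
  assumes u: "u \<in> V"
  shows "bij_betw fst (near_face E u) E"
proof (rule bij_betw_imageI)
  show "inj_on fst (near_face E u)"
  proof (rule inj_onI, clarsimp)
    fix e v w assume vw: "(e, v) \<in> near_face E u" "(e, w) \<in> near_face E u"
    show "v = w"
    proof (rule ccontr)
      assume "v \<noteq> w"
      then have "e = {v, w}" using vw edgeE unfolding mem_near_face by (metis insertE singletonD)
      then show False using vw edge_sides u unfolding mem_near_face by metis
    qed
  qed
  show "fst ` near_face E u = E"
  proof
    show "fst ` near_face E u \<subseteq> E" by (auto simp: mem_near_face)
    show "E \<subseteq> fst ` near_face E u"
    proof
      fix e assume e: "e \<in> E"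
      then obtain a b where ab: "e = {a, b}" using edge_card by (meson card_2_iff)
      then have "(e, a) \<in> near_face E u \<or> (e, b) \<in> near_face E u"
        using edge_sides u e by (auto simp: mem_near_face)
      then show "e \<in> fst ` near_face E u" by force
    qed
  qed
qed

lemma card_near_face: "u \<in> V \<Longrightarrow> card (near_face E u) = card E"
  using bij_betw_near_face bij_betw_same_card by blast

lemma near_face_adjacent_mem:
  assumes "{a, b} \<in> E" "e \<noteq> {a, b}"
  shows "(e, v) \<in> near_face E a \<longleftrightarrow> (e, v) \<in> near_face E b"
proof -
  have "linked (E - {e}) a b" using assms by (intro linked_edge) auto
  then show ?thesis unfolding mem_near_face using linked_commute linked_trans by metis
qed

lemma near_face_adjacent_new:
  assumes "{a, b} \<in> E"
  shows "({a, b}, a) \<notin> near_face E b"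
  using edge_ends_separated[OF assms] by (auto simp: mem_near_face linked_commute)

lemma near_face_adjacent_Int:
  assumes ab: "{a, b} \<in> E"
  shows "near_face E a \<inter> near_face E b = near_face E a - {({a, b}, a)}"
proof -
  have "c \<in> near_face E b" if "c \<in> near_face E a" "c \<noteq> ({a, b}, a)" for c
  proof (cases "fst c = {a, b}")
    case True
    then have "c = ({a, b}, b)" using that by (cases c) (auto simp: mem_near_face)
    then show ?thesis using near_face_self ab by auto
  next
    case False
    then show ?thesis using near_face_adjacent_mem[OF ab, of "fst c" "snd c"] that by auto
  qed
  then show ?thesis using near_face_adjacent_new[OF ab] by auto
qed

lemma near_face_start_edge:
  assumes "u \<in> V" "w \<in> V" "u \<noteq> w"
  shows "(start_edge E u w, u) \<in> near_face E u - near_face E w"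
  using start_edge_in[OF assms] by (auto simp: mem_near_face linked_commute)

lemma inj_near_face: "inj_on (near_face E) V"
  using near_face_start_edge by (intro inj_onI) blast

text \<open>Two half-trees have no vertex in common exactly when the path between their base vertices
  starts with one edge and ends with the other.\<close>

lemma opposed_iff_disjoint:
  assumes "(e, v) \<in> incidence V E" "(f, w) \<in> incidence V E"
  shows "v \<noteq> w \<and> start_edge E v w = e \<and> end_edge E v w = f \<longleftrightarrow>
    (\<nexists>u. u \<in> V \<and> (e, v) \<in> near_face E u \<and> (f, w) \<in> near_face E u)" (is "?L \<longleftrightarrow> ?R")
proof -
  have e: "e \<in> E" "v \<in> e" "v \<in> V" and f: "f \<in> E" "w \<in> f" "w \<in> V"
    using assms by (auto simp: incidence_def)
  have "?L \<longleftrightarrow> v \<noteq> w \<and> \<not> linked (E - {e}) v w \<and> \<not> linked (E - {f}) w v"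
    using start_edge_iff end_edge_eq e f by metis
  also have "\<dots> \<longleftrightarrow> ?R"
  proof
    assume L: "v \<noteq> w \<and> \<not> linked (E - {e}) v w \<and> \<not> linked (E - {f}) w v"
    show ?R
    proof
      assume "\<exists>u. u \<in> V \<and> (e, v) \<in> near_face E u \<and> (f, w) \<in> near_face E u"
      then obtain u where u: "linked (E - {e}) u v" "linked (E - {f}) u w"
        by (auto simp: mem_near_face)
      then have "linked (E - {f}) v u"
        using linked_side_avoiding L f(2) linked_commute by metis
      then show False using u(2) L linked_commute linked_trans by metis
    qed
  next
    assume ?R
    then have "(f, w) \<notin> near_face E v" "(e, v) \<notin> near_face E w"
      using near_face_self e f by blast+
    then show "v \<noteq> w \<and> \<not> linked (E - {e}) v w \<and> \<not> linked (E - {f}) w v"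
      using e f by (auto simp: mem_near_face linked_commute)
  qed
  finally show ?thesis .
qed

text \<open>The Helly property. If every vertex \<open>u\<close> misses the half-tree of some \<open>c u \<in> S\<close>, let \<open>h u\<close> be the
  first edge from \<open>u\<close> towards that half-tree. There are fewer edges than vertices, so \<open>h u = h w\<close> for
  some \<open>u \<noteq> w\<close>. Then the half-trees of \<open>c u\<close> and \<open>c w\<close> lie on different sides of the edge \<open>{u, w}\<close>,
  although they have a vertex in common.\<close>

lemma near_face_Helly:
  assumes S: "S \<subseteq> incidence V E"
    and meet: "\<And>c d. c \<in> S \<Longrightarrow> d \<in> S \<Longrightarrow> \<exists>u\<in>V. c \<in> near_face E u \<and> d \<in> near_face E u"
  shows "\<exists>u\<in>V. S \<subseteq> near_face E u"
proof (rule ccontr)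
  assume "\<not> ?thesis"
  then have "\<forall>u\<in>V. \<exists>c. c \<in> S - near_face E u" by blast
  then obtain c where c: "\<And>u. u \<in> V \<Longrightarrow> c u \<in> S - near_face E u" by metis
  define h where "h u = start_edge E u (snd (c u))" for u
  have h: "h u \<in> E \<and> u \<in> h u \<and> \<not> linked (E - {h u}) u (snd (c u)) \<and>
      snd (c u) \<in> V \<and> \<not> linked (E - {fst (c u)}) (snd (c u)) u" if u: "u \<in> V" for u
  proof -
    obtain e v where ev: "c u = (e, v)" by fastforce
    have *: "e \<in> E" "v \<in> e" "v \<in> V" using S c[OF u] ev by (auto simp: incidence_def)
    then have "\<not> linked (E - {e}) u v" using c[OF u] ev by (auto simp: mem_near_face)
    moreover have "u \<noteq> v" using calculation by auto
    ultimately show ?thesis using start_edge_in[OF u *(3)] ev * by (auto simp: h_def linked_commute)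
  qed
  have "\<not> inj_on h V"
  proof
    assume "inj_on h V"
    then have "card V \<le> card E" using h finite_E by (intro card_inj_on_le[of h]) auto
    then show False using card_vertices by simp
  qed
  then obtain u w where uw: "u \<in> V" "w \<in> V" "u \<noteq> w" "h u = h w" by (auto simp: inj_on_def)
  obtain e v where ev: "c u = (e, v)" by fastforce
  obtain f x where fx: "c w = (f, x)" by fastforce
  have "h u = {u, w}" using h[OF uw(1)] h[OF uw(2)] uw edgeE by (metis insertE singletonD)
  then have uwE: "{u, w} \<in> E" and hs: "h u = {u, w}" "h w = {u, w}"
    using h[OF uw(1)] uw by auto
  obtain y where y: "(e, v) \<in> near_face E y" "(f, x) \<in> near_face E y"
    using meet[of "c u" "c w"] c[OF uw(1)] c[OF uw(2)] ev fx by auto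
  have "linked (E - {{u, w}}) v y"
    using linked_side_avoiding[of E e v y u "{u, w}"] y(1) h[OF uw(1)] ev
    by (auto simp: mem_near_face linked_commute)
  moreover have "linked (E - {{u, w}}) x y"
    using linked_side_avoiding[of E f x y w "{u, w}"] y(2) h[OF uw(2)] fx
    by (auto simp: mem_near_face linked_commute)
  moreover have "\<not> linked (E - {{u, w}}) x w" "\<not> linked (E - {{u, w}}) v u"
      "v \<in> V"
    using h[OF uw(1)] h[OF uw(2)] hs ev fx by (auto simp: linked_commute)
  moreover have "linked (E - {{u, w}}) v w"
    using edge_sides[OF uwE] calculation by blast
  ultimately show False using linked_commute linked_trans by metis
qed

section \<open>The tree complex is stacked and not a cone\<close>

text \<open>The complex with vertex set \<^term>\<open>incidence V E\<close> whose facets are the sets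
  \<^term>\<open>near_face E u\<close> for \<open>u \<in> V\<close>.\<close>

definition tree_complex :: "('v set \<times> 'v) set set" where
  "tree_complex = generated_complex (near_face E ` V)"

lemma mem_tree_complex: "S \<in> tree_complex \<longleftrightarrow> (\<exists>u\<in>V. S \<subseteq> near_face E u)"
  by (auto simp: tree_complex_def generated_complex_def)

lemma abstract_tree_complex: "abstract_complex tree_complex"
proof -
  have "tree_complex \<subseteq> Pow (incidence V E)"
    unfolding subset_iff Pow_iff mem_tree_complex using near_face_subset by blast
  then have "finite tree_complex"
    using finite_incidence by (meson finite_Pow_iff finite_subset)
  moreover have "finite S" if "S \<in> tree_complex" for S
    using that finite_subset[OF _ finite_near_face] unfolding mem_tree_complex by blast
  moreover have "T \<in> tree_complex" if "S \<in> tree_complex" "T \<subseteq> S" for S T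
    using that unfolding mem_tree_complex by blast
  ultimately show ?thesis by (simp add: abstract_complex_def)
qed

lemma vertices_tree_complex: "complex_vertices tree_complex = incidence V E"
proof -
  have "\<Union>(near_face E ` V) = incidence V E"
    using near_face_subset near_face_self incidence_iff edge_subset by fastforce
  then show ?thesis by (simp add: tree_complex_def complex_vertices_generated)
qed

lemma facets_tree_complex: "facets tree_complex = near_face E ` V"
proof
  show "facets tree_complex \<subseteq> near_face E ` V"
  proof
    fix S assume S: "S \<in> facets tree_complex"
    then obtain u where u: "u \<in> V" "S \<subseteq> near_face E u"
      by (auto simp: facets_def mem_tree_complex)
    then have "near_face E u \<in> tree_complex" by (auto simp: mem_tree_complex)
    then have "S = near_face E u" using S u(2) by (simp add: facets_def)
    then show "S \<in> near_face E ` V" using u(1) by simp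
  qed
  show "near_face E ` V \<subseteq> facets tree_complex"
  proof clarify
    fix u assume u: "u \<in> V"
    have "near_face E u = G" if G: "G \<in> tree_complex" "near_face E u \<subseteq> G" for G
    proof -
      obtain w where w: "w \<in> V" "G \<subseteq> near_face E w" using G(1) by (auto simp: mem_tree_complex)
      then have "near_face E u = near_face E w"
        using G(2) u card_near_face finite_near_face by (intro card_subset_eq) auto
      then show ?thesis using G(2) w(2) by simp
    qed
    moreover have "near_face E u \<in> tree_complex"
      using u by (auto simp: mem_tree_complex)
    ultimately show "near_face E u \<in> facets tree_complex"
      by (simp add: facets_def)
  qed
qed

lemma dim_tree_complex: "complex_dim tree_complex = int (card E) - 1"
  unfolding complex_dim_def
proof (rule Max_eqI)
  show "finite (face_dim ` tree_complex)"
    using abstract_tree_complex by (simp add: abstract_complex_def)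
  obtain r where "r \<in> V" using V_nonempty by blast
  then show "int (card E) - 1 \<in> face_dim ` tree_complex"
    using card_near_face by (force simp: face_dim_def mem_tree_complex)
  fix d assume "d \<in> face_dim ` tree_complex"
  then obtain S u where "d = face_dim S" "u \<in> V" "S \<subseteq> near_face E u"
    by (auto simp: mem_tree_complex)
  then show "d \<le> int (card E) - 1"
    using card_mono[OF finite_near_face, of S u] card_near_face by (simp add: face_dim_def)
qed

lemma not_cone_tree_complex: "\<not> cone tree_complex"
proof
  assume "cone tree_complex"
  then obtain e v where ev: "(e, v) \<in> incidence V E" "\<And>u. u \<in> V \<Longrightarrow> (e, v) \<in> near_face E u"
    unfolding cone_def vertices_tree_complex facets_tree_complex by (metis imageI surj_pair)
  then obtain w where "e = {v, w}" "w \<in> V"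
    using edgeE by (metis incidence_iff)
  then show False using ev near_face_adjacent_new incidence_iff by metis
qed

text \<open>When \<open>x\<close> is attached to \<open>y\<close>, the only vertex of its facet that is not in the facet of \<open>y\<close> is the
  incidence of \<open>x\<close> with the edge \<open>{x, y}\<close>. All earlier vertices are on the other side of this edge.\<close>

lemma search_order_stacks:
  assumes "search_order E us" "set us \<subseteq> V" "1 \<le> p" "p < length us"
  shows "\<exists>G c. near_face E (us ! p) = G \<union> {c} \<and>
    G \<in> generated_complex (near_face E ` set (take p us)) \<and>
    c \<notin> complex_vertices (generated_complex (near_face E ` set (take p us)))"
  using assms
proof (induction rule: search_order.induct)
  case (attach us y x)
  show ?case
  proof (cases "p < length us")
    case True
    then show ?thesis
      using attach.IH attach.prems by (simp add: nth_append)
  next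
    case False
    let ?c = "({x, y}, x)"
    have p: "p = length us" using False attach.prems by simp
    have xy: "{x, y} \<in> E" using attach.hyps by (simp add: insert_commute)
    have "?c \<notin> near_face E w" if "w \<in> set us" for w
    proof -
      have "linked (E - {{x, y}}) y w"
        using search_order_linked[OF attach.hyps(1,2) that] attach.hyps(3) by auto
      then show ?thesis using edge_ends_separated[OF xy] linked_commute linked_trans
        unfolding mem_near_face by metis
    qed
    moreover have "near_face E x = (near_face E x \<inter> near_face E y) \<union> {?c}"
      using near_face_adjacent_Int[OF xy] near_face_self[OF xy, of x] by auto
    moreover have "near_face E x \<inter> near_face E y \<in> generated_complex (near_face E ` set us)"
      using attach.hyps(2) by (auto simp: generated_complex_def)
    ultimately show ?thesis
      unfolding complex_vertices_generated
      by (intro exI[of _ "near_face E x \<inter> near_face E y"] exI[of _ ?c]) (simp add: p)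
  qed
qed simp

lemma stacked_tree_complex: "stacked tree_complex"
proof -
  have "pure_complex tree_complex"
    using abstract_tree_complex dim_tree_complex card_near_face
    by (auto simp: pure_complex_def facets_tree_complex face_dim_def)
  moreover obtain us where us: "search_order E us" "set us = V"
    using search_order_exists[OF finite_V V_nonempty linked_all edge_subset] by metis
  have "set (map (near_face E) us) = facets tree_complex"
    using us by (simp add: facets_tree_complex)
  moreover have "distinct (map (near_face E) us)" "map (near_face E) us \<noteq> []"
    using search_order_distinct[OF us(1)] inj_near_face us(2) by (auto simp: distinct_map)
  moreover have "\<forall>p. 1 \<le> p \<and> p < length (map (near_face E) us) \<longrightarrow>
      (\<exists>G c. map (near_face E) us ! p = G \<union> {c} \<and>
        G \<in> generated_complex (set (take p (map (near_face E) us))) \<and>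
        c \<notin> complex_vertices (generated_complex (set (take p (map (near_face E) us)))))"
    using search_order_stacks[OF us(1)] us(2) by (simp add: take_map)
  ultimately show ?thesis unfolding stacked_def by metis
qed

section \<open>The hypertree of the tree complex\<close>

lemma adjacent_Int_not_subset:
  assumes ab: "{a, b} \<in> E" and v: "v \<in> V" "v \<noteq> a" "linked (E - {{a, b}}) a v"
  shows "\<not> near_face E a \<inter> near_face E b \<subseteq> near_face E v"
proof -
  have a: "a \<in> V" using edge_subset[OF ab] by simp
  let ?f = "start_edge E a v"
  have f: "(?f, a) \<in> near_face E a" "(?f, a) \<notin> near_face E v"
    using near_face_start_edge[OF a v(1)] v(2) by auto
  have "?f \<noteq> {a, b}" using start_edge_in[OF a v(1)] v by metis
  then have "(?f, a) \<in> near_face E b" using near_face_adjacent_mem[OF ab] f(1) by blast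
  then show ?thesis using f by blast
qed

lemma facets_over_adjacent_Int:
  assumes ab: "{a, b} \<in> E"
  shows "{v \<in> V. near_face E a \<inter> near_face E b \<subseteq> near_face E v} = {a, b}"
proof -
  have "v = a \<or> v = b" if v: "v \<in> V" "near_face E a \<inter> near_face E b \<subseteq> near_face E v" for v
  proof -
    have ba: "{b, a} \<in> E" using ab by (simp add: insert_commute)
    have "linked (E - {{a, b}}) a v \<or> linked (E - {{a, b}}) b v"
      using edge_sides[OF ab v(1)] linked_commute by metis
    then show ?thesis
      using adjacent_Int_not_subset[OF ab v(1)] adjacent_Int_not_subset[OF ba v(1)] v(2)
      by (metis Int_commute insert_commute)
  qed
  then show ?thesis using edge_subset[OF ab] by auto
qed

lemma card_adjacent_Int:
  assumes ab: "{a, b} \<in> E"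
  shows "card (near_face E a \<inter> near_face E b) + 1 = card E"
proof -
  have "({a, b}, a) \<in> near_face E a" using near_face_self ab by simp
  then have "card (near_face E a) = card (near_face E a \<inter> near_face E b) + 1"
    unfolding near_face_adjacent_Int[OF ab] using finite_near_face
    by (metis Suc_eq_plus1 card.remove)
  then show ?thesis using card_near_face edge_subset[OF ab] by simp
qed

text \<open>Every edge on the path from \<open>v\<close> to \<open>w\<close> accounts for an element of the facet of \<open>v\<close> that is
  not in the facet of \<open>w\<close>, so a common ridge leaves room for one edge only.\<close>

lemma common_ridge_adjacent:
  assumes vw: "v \<in> V" "w \<in> V" "v \<noteq> w"
    and G: "G \<subseteq> near_face E v" "G \<subseteq> near_face E w" "card G + 1 = card E"
  shows "{v, w} \<in> E \<and> G = near_face E v \<inter> near_face E w"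
proof -
  let ?h = "start_edge E v w"
  have h: "?h \<in> E" "v \<in> ?h" "\<not> linked (E - {?h}) v w"
    using start_edge_in[OF vw] by auto
  have hv: "(?h, v) \<in> near_face E v - near_face E w"
    using near_face_start_edge[OF vw] .
  obtain x where x: "?h = {v, x}" "v \<noteq> x" "x \<in> V" using edgeE[OF h(1,2)] by metis
  have "x = w"
  proof (rule ccontr)
    assume "x \<noteq> w"
    let ?k = "start_edge E x w"
    have k: "(?k, x) \<in> near_face E x - near_face E w"
      using near_face_start_edge[OF x(3) vw(2) \<open>x \<noteq> w\<close>] .
    have "linked (E - {?h}) x w"
      using edge_sides[of v x w] h x vw linked_commute by metis
    then have "?k \<noteq> ?h" using start_edge_in[OF x(3) vw(2) \<open>x \<noteq> w\<close>] by metis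
    then have "(?k, x) \<in> near_face E v"
      using near_face_adjacent_mem[of v x] h(1) x(1) k by auto
    then have "G \<subseteq> near_face E v - {(?h, v), (?k, x)}"
      and *: "{(?h, v), (?k, x)} \<subseteq> near_face E v"
      using G k hv by auto
    then have "card G \<le> card (near_face E v) - card {(?h, v), (?k, x)}"
      by (metis card_Diff_subset card_mono finite.emptyI finite.insertI finite_Diff finite_near_face)
    moreover have "card {(?h, v), (?k, x)} \<le> card (near_face E v)"
      using * finite_near_face by (intro card_mono)
    ultimately show False using G(3) card_near_face[OF vw(1)] \<open>?k \<noteq> ?h\<close> by simp
  qed
  then have E: "{v, w} \<in> E" using h x by simp
  moreover have "G = near_face E v \<inter> near_face E w"
    using G card_adjacent_Int[OF E] finite_near_face by (intro card_subset_eq) auto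
  ultimately show ?thesis by simp
qed

lemma hypertree_tree_complex: "hypertree_edges tree_complex V (near_face E) = E"
proof
  show "E \<subseteq> hypertree_edges tree_complex V (near_face E)"
  proof
    fix e assume e: "e \<in> E"
    then obtain a b where ab: "e = {a, b}" "{a, b} \<in> E" using edge_card by (metis card_2_iff)
    let ?G = "near_face E a \<inter> near_face E b"
    have "?G \<in> tree_complex" using edge_subset[OF e] ab by (auto simp: mem_tree_complex)
    moreover have "face_dim ?G = complex_dim tree_complex - 1"
      using card_adjacent_Int[OF ab(2)] by (simp add: face_dim_def dim_tree_complex)
    moreover have "e = {v \<in> V. ?G \<subseteq> near_face E v}"
      using facets_over_adjacent_Int[OF ab(2)] ab(1) by simp
    ultimately show "e \<in> hypertree_edges tree_complex V (near_face E)"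
      using edge_card[OF e] unfolding hypertree_edges_def by (simp add: bexI[of _ ?G])
  qed
  show "hypertree_edges tree_complex V (near_face E) \<subseteq> E"
  proof
    fix e assume "e \<in> hypertree_edges tree_complex V (near_face E)"
    then obtain G where G: "face_dim G = complex_dim tree_complex - 1"
        "e = {v \<in> V. G \<subseteq> near_face E v}" "2 \<le> card e"
      unfolding hypertree_edges_def by blast
    obtain v w where vw: "v \<in> e" "w \<in> e" "v \<noteq> w"
      using G(3) card_le_Suc0_iff_eq[of e] card.infinite[of e] by fastforce
    have "card G + 1 = card E"
      using G(1) by (simp add: face_dim_def dim_tree_complex)
    then have "{v, w} \<in> E" "G = near_face E v \<inter> near_face E w"
      using common_ridge_adjacent[of v w G] G(2) vw by auto
    then show "e \<in> E" using facets_over_adjacent_Int G(2) by metis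
  qed
qed

lemma associated_hypertree_tree_complex: "associated_hypertree tree_complex V E"
  unfolding associated_hypertree_def using inj_near_face hypertree_tree_complex
  by (intro exI[of _ "near_face E"]) (simp add: bij_betw_def facets_tree_complex)

section \<open>The Stanley--Reisner ideal\<close>

lemma nonface_tree_complex:
  assumes S: "S \<subseteq> incidence V E"
  shows "S \<notin> tree_complex \<longleftrightarrow> (\<exists>(e, v)\<in>S. \<exists>(f, w)\<in>S.
    v \<noteq> w \<and> start_edge E v w = e \<and> end_edge E v w = f)" (is "_ \<longleftrightarrow> ?opposed")
proof
  assume "S \<notin> tree_complex"
  then obtain c d where cd: "c \<in> S" "d \<in> S" "\<not> (\<exists>u\<in>V. c \<in> near_face E u \<and> d \<in> near_face E u)"
    using near_face_Helly[OF S] unfolding mem_tree_complex by blast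
  obtain e v f w where ev: "c = (e, v)" "d = (f, w)" by fastforce
  then have "v \<noteq> w \<and> start_edge E v w = e \<and> end_edge E v w = f"
    using cd S by (subst opposed_iff_disjoint) auto
  then show ?opposed using cd(1,2) ev by auto
next
  assume ?opposed
  then obtain e v f w where ev: "(e, v) \<in> S" "(f, w) \<in> S"
      "v \<noteq> w \<and> start_edge E v w = e \<and> end_edge E v w = f" by auto
  have "\<nexists>u. u \<in> V \<and> (e, v) \<in> near_face E u \<and> (f, w) \<in> near_face E u"
    using opposed_iff_disjoint[of e v f w] ev S by (metis subsetD)
  then show "S \<notin> tree_complex" using ev(1,2) unfolding mem_tree_complex by blast
qed

lemma tree_ideal_eq_stanley_reisner:
  "(tree_ideal V E :: ((('v set \<times> 'v) \<Rightarrow>\<^sub>0 nat) \<Rightarrow>\<^sub>0 'k::field) set)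
    = stanley_reisner_ideal tree_complex"
proof -
  let ?N = "{((start_edge E v w, v), (end_edge E v w, w)) |v w. v \<in> V \<and> w \<in> V \<and> v \<noteq> w}"
  have "(stanley_reisner_ideal tree_complex :: ((('v set \<times> 'v) \<Rightarrow>\<^sub>0 nat) \<Rightarrow>\<^sub>0 'k::field) set) =
    genideal (poly_ring_on (complex_vertices tree_complex))
      {poly_var c * poly_var d |c d. (c, d) \<in> ?N}"
  proof (rule stanley_reisner_ideal_eq_quadratic)
    show "finite (complex_vertices tree_complex)"
      by (simp add: vertices_tree_complex finite_incidence)
    show "c \<in> complex_vertices tree_complex \<and> d \<in> complex_vertices tree_complex \<and> c \<noteq> d"
      if cd: "(c, d) \<in> ?N" for c d
    proof -
      obtain v w where vw: "c = (start_edge E v w, v)" "d = (end_edge E v w, w)"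
          "v \<in> V" "w \<in> V" "v \<noteq> w"
        using cd by blast
      then have "c \<in> incidence V E" "d \<in> incidence V E"
        using start_edge_in[of v w] start_edge_in[of w v] end_edge_eq[of v w]
        by (simp_all add: incidence_iff)
      then show ?thesis using vw by (simp add: vertices_tree_complex)
    qed
    show "S \<notin> tree_complex \<longleftrightarrow> (\<exists>c\<in>S. \<exists>d\<in>S. (c, d) \<in> ?N)"
      if "S \<subseteq> complex_vertices tree_complex" for S
    proof -
      have S: "S \<subseteq> incidence V E" using that by (simp add: vertices_tree_complex)
      have "(\<exists>(e, v)\<in>S. \<exists>(f, w)\<in>S. v \<noteq> w \<and> start_edge E v w = e \<and> end_edge E v w = f) \<longleftrightarrow>
        (\<exists>c\<in>S. \<exists>d\<in>S. (c, d) \<in> ?N)"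
      proof
        assume "\<exists>(e, v)\<in>S. \<exists>(f, w)\<in>S. v \<noteq> w \<and> start_edge E v w = e \<and> end_edge E v w = f"
        then obtain v w where vw: "(start_edge E v w, v) \<in> S" "(end_edge E v w, w) \<in> S" "v \<noteq> w"
          by auto
        then have "v \<in> V" "w \<in> V" using S by (auto simp: incidence_def)
        then show "\<exists>c\<in>S. \<exists>d\<in>S. (c, d) \<in> ?N" using vw by blast
      qed auto
      then show ?thesis using nonface_tree_complex[OF S] by simp
    qed
  qed
  also have "{poly_var c * poly_var d |c d. (c, d) \<in> ?N} =
    {poly_var (start_edge E v w, v) * poly_var (end_edge E v w, w) |v w.
          v \<in> V \<and> w \<in> V \<and> v \<noteq> w}"
    by auto
  finally show ?thesis by (simp add: tree_ideal_def vertices_tree_complex)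
qed

section \<open>Uniqueness\<close>

lemma stacked_with_hypertree_unique:
  fixes Y :: "'b set set"
  assumes Y: "stacked Y" "complex_dim Y = int (card E) - 1" "\<not> cone Y"
    and tree_Y: "associated_hypertree Y V E"
  shows "complex_iso tree_complex Y"
proof -
  obtain F where F: "bij_betw F V (facets Y)" and edges: "hypertree_edges Y V F = E"
    using tree_Y unfolding associated_hypertree_def by (elim exE conjE)
  have pure: "pure_complex Y" and ac: "abstract_complex Y"
    using Y(1) by (auto simp: stacked_def pure_complex_def)
  have facet: "F v \<in> facets Y" if "v \<in> V" for v
    using F that by (auto simp: bij_betw_def)
  have card_facet: "card K = card E" if "K \<in> facets Y" for K
    using pure Y(2) that by (auto simp: pure_complex_def face_dim_def)
  have finite_facet: "finite (F v)" if "v \<in> V" for v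
    using facet[OF that] ac by (auto simp: abstract_complex_def facets_def)
  \<comment> \<open>For \<open>e = {v, w}\<close> the inner \<open>the_elem\<close> is \<open>w\<close>, and \<open>y (e, v)\<close> is the element of \<open>F v - F w\<close>.\<close>
  define y where "y = (\<lambda>(e, v). the_elem (F v - F (the_elem (e - {v}))))"
  have y: "F a - F b = {y ({a, b}, a)}" if ab: "{a, b} \<in> E" for a b
  proof -
    have V: "a \<in> V" "b \<in> V" and "a \<noteq> b" using edge_subset[OF ab] edge_ends_distinct[OF ab] by auto
    obtain G where G: "face_dim G = complex_dim Y - 1" "{a, b} = {v \<in> V. G \<subseteq> F v}"
      using ab edges unfolding hypertree_edges_def by blast
    have "G \<subseteq> F a \<inter> F b" using G(2) by blast
    then have "card G \<le> card (F a \<inter> F b)" using finite_facet V by (intro card_mono) auto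
    then have "card E \<le> card (F a \<inter> F b) + 1" using G(1) Y(2) by (simp add: face_dim_def)
    moreover have "F a \<inter> F b \<noteq> F a"
    proof
      assume "F a \<inter> F b = F a"
      then have "F a = F b"
        using card_facet facet finite_facet V by (intro card_subset_eq) auto
      then show False using F V \<open>a \<noteq> b\<close> by (auto simp: bij_betw_def inj_on_def)
    qed
    then have "card (F a \<inter> F b) < card (F a)"
      using finite_facet V by (intro psubset_card_mono) auto
    ultimately have "card (F a - F b) = 1"
      using card_facet[OF facet] V finite_facet by (simp add: card_Diff_subset_Int)
    then obtain x where "F a - F b = {x}" using card_1_singletonE by blast
    moreover have "{a, b} - {a} = {b}" using \<open>a \<noteq> b\<close> by auto
    ultimately show ?thesis by (simp add: y_def)
  qed
  have vertices_Y: "complex_vertices Y = \<Union>(facets Y)"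
    using generated_complex_facets[OF ac] complex_vertices_generated by metis
  \<comment> \<open>Along a path from a facet that contains a given vertex of \<open>Y\<close> to one that does not,
    the vertex is lost at some edge and is the value of \<open>y\<close> there.\<close>
  have surj: "y ` incidence V E = complex_vertices Y"
  proof
    show "y ` incidence V E \<subseteq> complex_vertices Y"
    proof clarify
      fix e v assume "(e, v) \<in> incidence V E"
      then have e: "e \<in> E" "v \<in> e" by (auto simp: incidence_iff)
      then obtain w where "e = {v, w}" "v \<in> V" using edgeE by metis
      then show "y (e, v) \<in> complex_vertices Y"
        using y[of v w] e(1) facet unfolding vertices_Y by blast
    qed
    show "complex_vertices Y \<subseteq> y ` incidence V E"
    proof
      fix x assume x: "x \<in> complex_vertices Y"
      then obtain v where v: "v \<in> V" "x \<in> F v"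
        using F unfolding vertices_Y by (auto simp: bij_betw_def)
      obtain K where "K \<in> facets Y" "x \<notin> K"
        using Y(3) x unfolding cone_def by blast
      then obtain w where w: "w \<in> V" "x \<notin> F w"
        using F unfolding bij_betw_def by (metis imageE)
      obtain a b where ab: "{a, b} \<in> E" "x \<in> F a" "x \<notin> F b"
        using linked_crossing[OF linked_all[OF v(1) w(1)], of "\<lambda>u. x \<in> F u"] v w by metis
      then have "x = y ({a, b}, a)" using y by blast
      moreover have "({a, b}, a) \<in> incidence V E" using ab(1) by (simp add: incidence_iff)
      ultimately show "x \<in> y ` incidence V E" by blast
    qed
  qed
  \<comment> \<open>Both complexes are stacked with equally many facets of equal size, so they have
    equally many vertices, and the surjection \<open>y\<close> is injective.\<close>
  have "card (complex_vertices Y) + 1 = card E + card V"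
    using stacked_card_vertices[OF Y(1) card_facet] bij_betw_same_card[OF F] by simp
  moreover have "card (incidence V E) + 1 = card E + card V"
    using stacked_card_vertices[OF stacked_tree_complex] card_near_face card_image[OF inj_near_face]
    by (auto simp: facets_tree_complex vertices_tree_complex)
  ultimately have "inj_on y (incidence V E)"
    using surj by (intro eq_card_imp_inj_on finite_incidence) simp
  then have bij: "bij_betw y (complex_vertices tree_complex) (complex_vertices Y)"
    using surj by (simp add: bij_betw_def vertices_tree_complex)
  have image: "y ` near_face E u = F u" if u: "u \<in> V" for u
  proof (rule card_subset_eq[OF finite_facet[OF u]])
    show "y ` near_face E u \<subseteq> F u"
    proof clarify
      fix e v assume ev: "(e, v) \<in> near_face E u"
      then have e: "e \<in> E" "v \<in> e" and L: "linked (E - {e}) v u"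
        by (auto simp: mem_near_face linked_commute)
      then obtain w where w: "e = {v, w}" using edgeE by metis
      show "y (e, v) \<in> F u"
      proof (rule ccontr)
        assume "y (e, v) \<notin> F u"
        \<comment> \<open>The path from \<open>v\<close> to \<open>u\<close> avoids \<open>e\<close>, so \<open>y (e, v)\<close> would be lost at a second edge.\<close>
        moreover have "y (e, v) \<in> F v" using y[of v w] e w by auto
        ultimately obtain a b where ab: "{a, b} \<in> E - {e}" "y (e, v) \<in> F a" "y (e, v) \<notin> F b"
          using linked_crossing[OF L, of "\<lambda>u. y (e, v) \<in> F u"] by metis
        then have "y (e, v) = y ({a, b}, a)" using y[of a b] by auto
        then have "(e, v) = ({a, b}, a)"
          using \<open>inj_on y (incidence V E)\<close> e ab(1) by (auto dest!: inj_onD simp: incidence_iff)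
        then show False using ab(1) by simp
      qed
    qed
    have "inj_on y (near_face E u)"
      using \<open>inj_on y (incidence V E)\<close> near_face_subset inj_on_subset by blast
    then show "card (y ` near_face E u) = card (F u)"
      using card_image card_near_face card_facet facet u by metis
  qed
  have "(\<lambda>S. y ` S) ` tree_complex = generated_complex ((\<lambda>S. y ` S) ` near_face E ` V)"
    unfolding tree_complex_def by (rule image_generated_complex)
  also have "(\<lambda>S. y ` S) ` near_face E ` V = facets Y"
    using image F by (auto simp: bij_betw_def image_image)
  also have "generated_complex (facets Y) = Y"
    using ac by (rule generated_complex_facets)
  finally show ?thesis using bij unfolding complex_iso_def by blast
qed

end

theorem corollary4p3:
  fixes V :: "'v set" and E :: "'v set set"
  assumes "finite_tree V E"
  shows "card V = card E + 1 \<and>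
    (\<exists>X :: ('v set \<times> 'v) set set.
       complex_vertices X = incidence V E \<and>
       (tree_ideal V E :: ((('v set \<times> 'v) \<Rightarrow>\<^sub>0 nat) \<Rightarrow>\<^sub>0 'k::field) set) = stanley_reisner_ideal X \<and>
       stacked X \<and> complex_dim X = int (card E) - 1 \<and> \<not> cone X \<and> associated_hypertree X V E \<and>
       (\<forall>Y :: 'b set set.
          stacked Y \<and> complex_dim Y = int (card E) - 1 \<and> \<not> cone Y \<and> associated_hypertree Y V E
          \<longrightarrow> complex_iso X Y))"
proof -
  interpret tree V E by unfold_locales (rule assms)
  show ?thesis
  proof (intro conjI exI[of _ tree_complex])
    show "\<forall>Y :: 'b set set. stacked Y \<and> complex_dim Y = int (card E) - 1 \<and> \<not> cone Y \<and>
        associated_hypertree Y V E \<longrightarrow> complex_iso tree_complex Y"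
      using stacked_with_hypertree_unique by blast
  qed (fact card_vertices vertices_tree_complex tree_ideal_eq_stanley_reisner stacked_tree_complex
      dim_tree_complex not_cone_tree_complex associated_hypertree_tree_complex)+
qed

end
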